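(* For any finite graph $G$ we have $\alpha(G[k])=O\left(k^{\alpha(G)-1}\right)$ as $k\to\infty$; that is, there is a constant $C$ depending only on $G$ such that $\alpha(G[k])\leq C\,k^{\alpha(G)-1}$ for all integers $k\geq 1$.
   Context: Graphs are finite, simple and undirected; $\alpha(\cdot)$ denotes the independence number (the maximum size of a set of pairwise non-adjacent vertices). For a finite graph $G$ with vertex set $V$ and $k\in\mathbb{N}$, the graph $G[k]$ is defined as follows. Its vertices are the configurations of $k$ identical pebbles on the vertices of $G$, i.e. the functions $f:V\to\mathbb{Z}_{\geq 0}$ with $\sum_{v\in V} f(v)=k$. Two distinct configurations $f$ and $g$ are adjacent in $G[k]$ if $g$ can be obtained from $f$ by (simultaneously) moving some of the pebbles, each moved pebble going to a neighbour in $G$ of the vertex it lies on; that is, if there are maps $\varphi,\gamma:\{1,\dots,k\}\to V$ with $|\varphi^{-1}(v)|=f(v)$ and $|\gamma^{-1}(v)|=g(v)$ for all $v\in V$, such that for every $i$ either $\varphi(i)=\gamma(i)$ or $\varphi(i)$ and $\gamma(i)$ are adjacent in $G$. (Equivalently, $G[k]$ is the quotient of the $k$-fold strong power $G^{\boxtimes k}$ by the action of the symmetric group $S_k$ permuting coordinates.) *)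

theory Defs
  imports Complex_Main "HOL-Library.FuncSet" "Graph_Theory.Pair_Digraph"
begin

text \<open>
  A finite simple undirected graph is a \<^locale>\<open>pair_graph\<close>: finitely many vertices,
  no loops, and an undirected edge between u and v is the pair of opposite arcs (u,v), (v,u).
\<close>

definition independent_sets :: "'a pair_pre_digraph \<Rightarrow> 'a set set" where
  "independent_sets G = {S. S \<subseteq> pverts G \<and> pairwise (\<lambda>u v. (u, v) \<notin> parcs G) S}"

text \<open>The maximum below is only meaningful when the vertex set is finite.\<close>

definition independence_number :: "'a pair_pre_digraph \<Rightarrow> nat" where
  "independence_number G = Max (card ` independent_sets G)"

text \<open>
  Configurations are extensional, so that they correspond exactly to functions
  defined on the vertex set only.
\<close>

definition configurations :: "'a pair_pre_digraph \<Rightarrow> nat \<Rightarrow> ('a \<Rightarrow> nat) set" where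
  "configurations G k = {f \<in> pverts G \<rightarrow>\<^sub>E UNIV. (\<Sum>v\<in>pverts G. f v) = k}"

definition pebble_move :: "'a pair_pre_digraph \<Rightarrow> nat \<Rightarrow> ('a \<Rightarrow> nat) \<Rightarrow> ('a \<Rightarrow> nat) \<Rightarrow> bool" where
  "pebble_move G k f g \<longleftrightarrow>
    (\<exists>\<phi> \<in> {1..k} \<rightarrow> pverts G. \<exists>\<gamma> \<in> {1..k} \<rightarrow> pverts G.
      (\<forall>v \<in> pverts G. card {i \<in> {1..k}. \<phi> i = v} = f v) \<and>
      (\<forall>v \<in> pverts G. card {i \<in> {1..k}. \<gamma> i = v} = g v) \<and>
      (\<forall>i \<in> {1..k}. \<phi> i = \<gamma> i \<or> (\<phi> i, \<gamma> i) \<in> parcs G))"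

definition pebble_graph :: "'a pair_pre_digraph \<Rightarrow> nat \<Rightarrow> ('a \<Rightarrow> nat) pair_pre_digraph" where
  "pebble_graph G k =
    \<lparr> pverts = configurations G k,
      parcs = {(f, g). f \<in> configurations G k \<and> g \<in> configurations G k \<and>
                       f \<noteq> g \<and> pebble_move G k f g} \<rparr>"

lemma finite_configurations:
  assumes "finite (pverts G)"
  shows "finite (configurations G k)"
proof (rule finite_subset)
  show "configurations G k \<subseteq> pverts G \<rightarrow>\<^sub>E {..k}"
  proof
    fix f assume f: "f \<in> configurations G k"
    have "f v \<le> k" if "v \<in> pverts G" for v
      using f that assms member_le_sum[of v "pverts G" f] by (auto simp: configurations_def)
    then show "f \<in> pverts G \<rightarrow>\<^sub>E {..k}"
      using f by (auto simp: configurations_def PiE_iff)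
  qed
  show "finite (pverts G \<rightarrow>\<^sub>E {..k})"
    using assms by (intro finite_PiE) auto
qed

lemma pebble_move_sym:
  assumes "sym (parcs G)" "pebble_move G k f g"
  shows "pebble_move G k g f"
proof -
  obtain \<phi> \<gamma> where "\<phi> \<in> {1..k} \<rightarrow> pverts G" "\<gamma> \<in> {1..k} \<rightarrow> pverts G"
    "\<forall>v \<in> pverts G. card {i \<in> {1..k}. \<phi> i = v} = f v"
    "\<forall>v \<in> pverts G. card {i \<in> {1..k}. \<gamma> i = v} = g v"
    "\<forall>i \<in> {1..k}. \<phi> i = \<gamma> i \<or> (\<phi> i, \<gamma> i) \<in> parcs G"
    using assms(2) unfolding pebble_move_def by blast
  moreover from this(5) have "\<forall>i \<in> {1..k}. \<gamma> i = \<phi> i \<or> (\<gamma> i, \<phi> i) \<in> parcs G"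
    using assms(1) by (metis symD)
  ultimately show ?thesis
    unfolding pebble_move_def by blast
qed

lemma pair_graph_pebble_graph:
  assumes "pair_graph G"
  shows "pair_graph (pebble_graph G k)"
proof -
  interpret pair_graph G by fact
  have fin: "finite (configurations G k)"
    by (rule finite_configurations) simp
  have sym: "sym (parcs G)"
    using pair_sym_arcs by (simp add: symmetric_def)
  show ?thesis
  proof
    show "finite (pverts (pebble_graph G k))"
      using fin by (simp add: pebble_graph_def)
    show "finite (parcs (pebble_graph G k))"
      by (rule finite_subset[of _ "configurations G k \<times> configurations G k"])
         (auto simp: pebble_graph_def fin)
    show "symmetric (with_proj (pebble_graph G k))"
      using pebble_move_sym[OF sym] by (auto simp: pebble_graph_def symmetric_def intro!: symI)
  qed (auto simp: pebble_graph_def)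
qed

end

theory Submission
  imports Defs
begin

text \<open>
  Processing the vertices by decreasing number of pebbles, greedily select an independent set
  and attach every other vertex to a selected neighbour carrying at least as many pebbles. This
  partitions the graph into at most \<open>\<alpha>(G)\<close> stars. Once the partition is fixed, the star totals sum
  to \<open>k\<close>, so they take only \<open>O(k\<^sup>\<alpha>\<^sup>-\<^sup>1)\<close> values. In a star of total \<open>t\<close> the centre carries at least
  \<open>t / n\<close> pebbles, so two configurations with the same totals whose leaves differ by at most
  \<open>t / n\<^sup>2\<close> are adjacent: all surpluses and deficits are balanced through the centre. Rounding
  the leaves to multiples of \<open>t / n\<^sup>2\<close> leaves boundedly many classes for given totals.
\<close>

section \<open>Bounds on the independence number\<close>

lemma finite_independent_sets:
  assumes "finite (pverts G)"
  shows "finite (independent_sets G)"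
  using assms by (auto simp: independent_sets_def intro: finite_subset[of _ "Pow (pverts G)"])

lemma card_le_independence_number:
  assumes "finite (pverts G)" "S \<in> independent_sets G"
  shows "card S \<le> independence_number G"
  unfolding independence_number_def using assms finite_independent_sets[of G] by (intro Max_ge) auto

lemma independence_number_le:
  assumes "finite (pverts G)" "\<And>S. S \<in> independent_sets G \<Longrightarrow> card S \<le> b"
  shows "independence_number G \<le> b"
proof -
  have "{} \<in> independent_sets G"
    by (simp add: independent_sets_def)
  then show ?thesis
    using assms finite_independent_sets[of G] unfolding independence_number_def
    by (subst Max_le_iff) auto
qed

section \<open>Star partitions from greedy independent sets\<close>

text \<open>A vertex treated after those with at least as many pebbles either has a neighbour
  already in \<open>I\<close>, which then dominates it, or can itself join \<open>I\<close>.\<close>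

lemma greedy_independent_set:
  fixes f :: "'a \<Rightarrow> nat"
  assumes "sym E" "finite W"
  shows "\<exists>I\<subseteq>W. pairwise (\<lambda>u v. (u, v) \<notin> E) I \<and>
    (\<forall>v\<in>W. \<exists>i\<in>I. (v = i \<or> (v, i) \<in> E) \<and> f v \<le> f i)"
  using assms(2)
\<comment> \<open>Negating \<open>f\<close> in the integers makes each newly inserted vertex one
  with the fewest pebbles so far.\<close>
proof (induction W rule: finite_ranking_induct[where f = "\<lambda>v. - int (f v)"])
  case empty
  then show ?case by auto
next
  case (insert x W)
  then obtain I where I: "I \<subseteq> W" "pairwise (\<lambda>u v. (u, v) \<notin> E) I"
    "\<forall>v\<in>W. \<exists>i\<in>I. (v = i \<or> (v, i) \<in> E) \<and> f v \<le> f i"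
    by blast
  show ?case
  proof (cases "\<exists>i\<in>I. (x, i) \<in> E")
    case True
    then obtain i where "i \<in> I" "(x, i) \<in> E" by blast
    moreover from this have "f x \<le> f i"
      using I(1) insert(2) by force
    ultimately show ?thesis
      using I by (intro exI[of _ I]) auto
  next
    case False
    then have "pairwise (\<lambda>u v. (u, v) \<notin> E) (insert x I)"
      using I(2) assms(1) by (auto simp: pairwise_insert dest: symD)
    then show ?thesis
      using I(1,3) by (intro exI[of _ "insert x I"]) auto
  qed
qed

text \<open>A partition into stars is encoded as the idempotent map sending each vertex to its
  centre. Independence of the image caps the number of stars; extensionality makes these maps
  countable by \<open>n ^ n\<close>.\<close>

definition star_map :: "'a pair_pre_digraph \<Rightarrow> ('a \<Rightarrow> 'a) \<Rightarrow> bool" where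
  "star_map G p \<longleftrightarrow> p \<in> pverts G \<rightarrow>\<^sub>E pverts G \<and> p ` pverts G \<in> independent_sets G \<and>
    (\<forall>v\<in>pverts G. p (p v) = p v \<and> (v = p v \<or> (v, p v) \<in> parcs G))"

lemma ex_dominating_star_map:
  fixes f :: "'a \<Rightarrow> nat"
  assumes "sym (parcs G)" "finite (pverts G)"
  shows "\<exists>p. star_map G p \<and> (\<forall>v\<in>pverts G. f v \<le> f (p v))"
proof -
  obtain I where I: "I \<subseteq> pverts G" "pairwise (\<lambda>u v. (u, v) \<notin> parcs G) I"
    "\<forall>v\<in>pverts G. \<exists>i\<in>I. (v = i \<or> (v, i) \<in> parcs G) \<and> f v \<le> f i"
    using greedy_independent_set[OF assms] by blast
  from I(3) obtain p where p: "\<forall>v\<in>pverts G. p v \<in> I \<and> (v = p v \<or> (v, p v) \<in> parcs G) \<and> f v \<le> f (p v)"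
    by metis
  \<comment> \<open>\<open>p i\<close> lies in \<open>I\<close> and equals or neighbours
    \<open>i\<close>; independence of \<open>I\<close> excludes a distinct neighbour.\<close>
  have fixed: "p i = i" if "i \<in> I" for i
    using p that I(1,2) by (metis pairwiseD subsetD)
  have "pairwise (\<lambda>u v. (u, v) \<notin> parcs G) (p ` pverts G)"
    using p by (intro pairwise_subset[OF I(2)]) auto
  then show ?thesis
    using p I(1) fixed
    by (intro exI[of _ "restrict p (pverts G)"])
       (auto simp: star_map_def independent_sets_def subset_iff)
qed

section \<open>Pebble moves from transport matrices\<close>

text \<open>Read \<open>m u v\<close> as the number of pebbles travelling from \<open>u\<close> to
  \<open>v\<close>. Listing these pebbles one by one and numbering them by \<open>{1..k}\<close>
  yields the two maps as source and target of each pebble.\<close>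

lemma pebble_move_of_transport:
  assumes fin: "finite (pverts G)"
    and f: "f \<in> configurations G k"
    and rows: "\<And>u. u \<in> pverts G \<Longrightarrow> (\<Sum>v\<in>pverts G. m u v) = f u"
    and cols: "\<And>v. v \<in> pverts G \<Longrightarrow> (\<Sum>u\<in>pverts G. m u v) = g v"
    and supp: "\<And>u v. \<lbrakk>u \<in> pverts G; v \<in> pverts G; 0 < m u v\<rbrakk> \<Longrightarrow> u = v \<or> (u, v) \<in> parcs G"
  shows "pebble_move G k f g"
proof -
  define V where "V = pverts G"
  \<comment> \<open>The triple \<open>(u, v, j)\<close> stands for one pebble going from
    \<open>u\<close> to \<open>v\<close>.\<close>
  define T where "T = (SIGMA u:V. SIGMA v:V. {..<m u v :: nat})"
  have fV: "finite V" using fin by (simp add: V_def)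
  have "card T = k"
    using f rows fV by (simp add: T_def configurations_def V_def)
  moreover have fT: "finite T"
    using fV by (simp add: T_def)
  ultimately obtain b where b: "bij_betw b {1..k} T"
    using ex_bij_betw_nat_finite_1 by blast
  have count: "card {i \<in> {1..k}. h (b i) = v} = card {x \<in> T. h x = v}" for h :: "_ \<Rightarrow> 'a" and v
  proof (rule bij_betw_same_card[of b])
    show "bij_betw b {i \<in> {1..k}. h (b i) = v} {x \<in> T. h x = v}"
      using bij_betw_Collect[OF b, of "\<lambda>x. h x = v" "\<lambda>i. h (b i) = v"] by simp
  qed
  have row: "card {x \<in> T. fst x = u} = f u" if "u \<in> V" for u
  proof -
    have "{x \<in> T. fst x = u} = {u} \<times> (SIGMA v:V. {..<m u v})"
      using that by (auto simp: T_def)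
    then show ?thesis
      using rows that fV by (simp add: card_cartesian_product V_def)
  qed
  have col: "card {x \<in> T. fst (snd x) = v} = g v" if "v \<in> V" for v
  proof -
    have "{x \<in> T. fst (snd x) = v} = (SIGMA u:V. {v} \<times> {..<m u v})"
      using that by (auto simp: T_def)
    then show ?thesis
      using cols that fV by (simp add: card_cartesian_product V_def)
  qed
  have bT: "b i \<in> T" if "i \<in> {1..k}" for i
    using b that by (auto simp: bij_betw_def)
  have "(\<lambda>i. fst (b i)) \<in> {1..k} \<rightarrow> V" "(\<lambda>i. fst (snd (b i))) \<in> {1..k} \<rightarrow> V"
    using bT by (force simp: T_def)+
  moreover have "fst (b i) = fst (snd (b i)) \<or> (fst (b i), fst (snd (b i))) \<in> parcs G"
    if "i \<in> {1..k}" for i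
    using bT[OF that] supp by (force simp: T_def V_def)
  moreover have "card {i \<in> {1..k}. fst (b i) = v} = f v"
    "card {i \<in> {1..k}. fst (snd (b i)) = v} = g v" if "v \<in> V" for v
    using that count[of fst v] count[of "\<lambda>x. fst (snd x)" v] row col by simp_all
  ultimately show ?thesis
    unfolding pebble_move_def V_def[symmetric]
    by (intro rev_bexI[of "\<lambda>i. fst (b i)", OF _ rev_bexI[of "\<lambda>i. fst (snd (b i))"]] conjI ballI)
qed

definition star :: "'a pair_pre_digraph \<Rightarrow> ('a \<Rightarrow> 'a) \<Rightarrow> 'a \<Rightarrow> 'a set" where
  "star G p i = {v \<in> pverts G. p v = i}"

text \<open>Each leaf sends its surplus to its centre and has its deficit filled from there. All
  pebbles move at once, so the centre must pay the deficits out of its own \<open>f i\<close>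
  pebbles; equality of the star totals then leaves it with exactly \<open>g i\<close>.\<close>

lemma pebble_move_through_centres:
  assumes sym: "sym (parcs G)" and fin: "finite (pverts G)"
    and p: "star_map G p"
    and f: "f \<in> configurations G k"
    and tot: "\<And>i. i \<in> p ` pverts G \<Longrightarrow> sum f (star G p i) = sum g (star G p i)"
    and deficit: "\<And>i. i \<in> p ` pverts G \<Longrightarrow> (\<Sum>v\<in>star G p i - {i}. g v - f v) \<le> f i"
  shows "pebble_move G k f g"
proof -
  define V where "V = pverts G"
  define D where "D i = (\<Sum>v\<in>star G p i - {i}. g v - f v)" for i
  \<comment> \<open>Truncated subtraction separates surplus \<open>f u - g u\<close> from deficit
    \<open>g v - f v\<close>: for each leaf at most one is nonzero. A centre keeps what remains
    after paying \<open>D u\<close>.\<close>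
  define m where "m u v =
    (if u = v then (if p u = u then f u - D u else min (f u) (g u))
     else if v = p u then f u - g u else if u = p v then g v - f v else 0)" for u v
  have fV: "finite V" using fin by (simp add: V_def)
  have fS: "finite (star G p i)" for i using fin by (simp add: star_def)
  have pV: "p u \<in> V" "p (p u) = p u" if "u \<in> V" for u
    using p that by (auto simp: star_map_def V_def)
  \<comment> \<open>This and \<open>centre\<close> take an arbitrary \<open>h\<close>, so that they
    serve both the rows and the columns of \<open>m\<close>.\<close>
  have leaf: "(\<Sum>v\<in>V. h v) = h u + h (p u)"
    if "u \<in> V" "p u \<noteq> u" "\<And>v. v \<in> V \<Longrightarrow> v \<noteq> u \<Longrightarrow> v \<noteq> p u \<Longrightarrow> h v = 0" for h :: "'a \<Rightarrow> nat" and u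
  proof -
    have "(\<Sum>v\<in>V. h v) = (\<Sum>v\<in>{u, p u}. h v)"
      using that fV pV by (intro sum.mono_neutral_right) auto
    then show ?thesis using that(2) by simp
  qed
  have centre: "(\<Sum>v\<in>V. h v) = h i + (\<Sum>v\<in>star G p i - {i}. h v)"
    if "i \<in> V" "p i = i" "\<And>v. v \<in> V \<Longrightarrow> p v \<noteq> i \<Longrightarrow> h v = 0" for h :: "'a \<Rightarrow> nat" and i
  proof -
    have "(\<Sum>v\<in>V. h v) = (\<Sum>v\<in>star G p i. h v)"
      using that fV by (intro sum.mono_neutral_right) (auto simp: star_def V_def)
    then show ?thesis
      using that fS by (simp add: sum.remove[of _ i] star_def V_def)
  qed
  show ?thesis
  proof (rule pebble_move_of_transport[OF fin f, of m], fold V_def)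
    fix u assume u: "u \<in> V"
    show "(\<Sum>v\<in>V. m u v) = f u"
    proof (cases "p u = u")
      case True
      have "(\<Sum>v\<in>star G p u - {u}. m u v) = D u"
        unfolding D_def using True by (intro sum.cong) (auto simp: m_def star_def)
      moreover have "D u \<le> f u"
        using deficit[of u] True u unfolding D_def by (metis V_def imageI)
      moreover have "m u u = f u - D u"
        using True by (simp add: m_def)
      ultimately show ?thesis
        using True u by (subst centre[of u]) (auto simp: m_def)
    next
      case False
      then show ?thesis
        using u pV by (subst leaf[of u]) (auto simp: m_def)
    qed
  next
    fix u assume u: "u \<in> V"
    show "(\<Sum>v\<in>V. m v u) = g u"
    proof (cases "p u = u")
      case True
      have *: "(\<Sum>v\<in>star G p u - {u}. m v u) = (\<Sum>v\<in>star G p u - {u}. f v - g v)"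
        using True by (intro sum.cong) (auto simp: m_def star_def)
      have "D u \<le> f u" "sum f (star G p u) = sum g (star G p u)"
        using deficit[of u] tot[of u] True u unfolding D_def by (metis V_def imageI)+
      moreover have "sum f (star G p u) = f u + sum f (star G p u - {u})"
        "sum g (star G p u) = g u + sum g (star G p u - {u})"
        using u True fS by (simp_all add: sum.remove[of _ u] star_def V_def)
      \<comment> \<open>Both sides add up \<open>max (f v) (g v)\<close> over the leaves.\<close>
      moreover have "D u + sum f (star G p u - {u}) = (\<Sum>v\<in>star G p u - {u}. f v - g v) + sum g (star G p u - {u})"
        unfolding D_def sum.distrib[symmetric] by (intro sum.cong) auto
      moreover have "m u u = f u - D u"
        using True by (simp add: m_def)
      ultimately have "m u u + (\<Sum>v\<in>star G p u - {u}. m v u) = g u"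
        unfolding * by linarith
      then show ?thesis
        using True u by (subst centre[of u]) (auto simp: m_def)
    next
      case False
      then show ?thesis
        using u pV by (subst leaf[of u]) (auto simp: m_def)
    qed
  next
    fix u v assume "u \<in> V" "v \<in> V" "0 < m u v"
    then show "u = v \<or> (u, v) \<in> parcs G"
      using p sym by (auto simp: m_def star_map_def V_def split: if_splits dest: symD)
  qed
qed

section \<open>Adjacency of configurations with equal rounding\<close>

text \<open>Equal quotients place \<open>a * c\<close> and \<open>b * c\<close> in the same interval
  of length \<open>t\<close>.\<close>

lemma diff_le_of_div_eq:
  fixes a b c t :: nat
  assumes "a * c div t = b * c div t" "b \<le> t"
  shows "(b - a) * c \<le> t"
proof (cases "t = 0")
  case False
  have "b * c = b * c div t * t + b * c mod t" by simp
  also have "\<dots> < a * c div t * t + t"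
    unfolding assms(1) using mod_less_divisor[of t "b * c"] False by linarith
  also have "\<dots> \<le> a * c + t" by simp
  finally have "b * c < a * c + t" .
  then show ?thesis by (simp add: diff_mult_distrib)
\<comment> \<open>For \<open>t = 0\<close> all quotients are 0, and the claim comes from
  \<open>b \<le> t\<close>.\<close>
qed (use assms in simp)

text \<open>Indexing by all vertices keeps the domain independent of \<open>p\<close>; vertices that
  are not centres have an empty fibre and get 0.\<close>

definition star_total :: "'a pair_pre_digraph \<Rightarrow> ('a \<Rightarrow> 'a) \<Rightarrow> ('a \<Rightarrow> nat) \<Rightarrow> 'a \<Rightarrow> nat" where
  "star_total G p f = (\<lambda>i\<in>pverts G. sum f (star G p i))"

text \<open>With \<open>t\<close> the total of its star, this measures \<open>f v\<close> in units
  of \<open>t / n^2\<close>. Multiplying first stays within the naturals, and a star without pebbles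
  yields 0.\<close>

definition rounding :: "'a pair_pre_digraph \<Rightarrow> ('a \<Rightarrow> 'a) \<Rightarrow> ('a \<Rightarrow> nat) \<Rightarrow> 'a \<Rightarrow> nat" where
  "rounding G p f = (\<lambda>v\<in>pverts G. f v * (card (pverts G))\<^sup>2 div sum f (star G p (p v)))"

text \<open>At most \<open>n\<close> vertices of a star each lack at most \<open>t / n^2\<close>
  pebbles, so the deficits sum to at most \<open>t / n\<close>, which the dominating centre
  holds.\<close>

lemma pebble_move_of_same_rounding:
  assumes sym: "sym (parcs G)" and fin: "finite (pverts G)"
    and p: "star_map G p"
    and f: "f \<in> configurations G k"
    and dom: "\<And>v. v \<in> pverts G \<Longrightarrow> f v \<le> f (p v)"
    and tot: "star_total G p f = star_total G p g"
    and rnd: "rounding G p f = rounding G p g"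
  shows "pebble_move G k f g"
proof -
  define n where "n = card (pverts G)"
  have tot': "sum f (star G p i) = sum g (star G p i)" if "i \<in> pverts G" for i
    using fun_cong[OF tot, of i] that by (simp add: star_total_def)
  have pV: "p v \<in> pverts G" if "v \<in> pverts G" for v
    using p that by (auto simp: star_map_def)
  show ?thesis
  proof (rule pebble_move_through_centres[OF sym fin p f])
    fix i assume i: "i \<in> p ` pverts G"
    then have iV: "i \<in> pverts G" using pV by auto
    show "sum f (star G p i) = sum g (star G p i)"
      using tot' iV by simp
    define S where "S = star G p i"
    define t where "t = sum f S"
    have S: "S \<subseteq> pverts G" by (auto simp: S_def star_def)
    have fS: "finite S" using S fin finite_subset by blast
    have cS: "card S \<le> n" using S fin card_mono n_def by blast
    have "n > 0" using iV fin by (auto simp: n_def card_gt_0_iff)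
    have le: "(g v - f v) * n\<^sup>2 \<le> t" if "v \<in> S" for v
    proof (rule diff_le_of_div_eq)
      have "v \<in> pverts G" "p v = i" using that by (auto simp: S_def star_def)
      then show "f v * n\<^sup>2 div t = g v * n\<^sup>2 div t"
        using fun_cong[OF rnd, of v] tot'[OF iV] by (simp add: rounding_def n_def t_def S_def)
      show "g v \<le> t"
        using that tot'[OF iV] fS by (simp add: t_def S_def member_le_sum)
    qed
    \<comment> \<open>The centre carries the maximum of \<open>f\<close> on its star, hence at least
      the average.\<close>
    have "t \<le> card S * f i"
      using dom sum_bounded_above[of S f "f i"] by (auto simp: t_def S_def star_def)
    also have "\<dots> \<le> n * f i"
      using cS by simp
    finally have t: "t \<le> n * f i" .
    have "(\<Sum>v\<in>S. g v - f v) * n\<^sup>2 \<le> card S * t"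
      using le sum_bounded_above[of S "\<lambda>v. (g v - f v) * n\<^sup>2" t] by (simp add: sum_distrib_right)
    also have "\<dots> \<le> n * (n * f i)"
      using cS t by (intro mult_le_mono)
    finally have "(\<Sum>v\<in>S. g v - f v) \<le> f i"
      using \<open>n > 0\<close> by (simp add: power2_eq_square mult_ac)
    moreover have "(\<Sum>v\<in>S - {i}. g v - f v) \<le> (\<Sum>v\<in>S. g v - f v)"
      using fS by (intro sum_mono2) auto
    ultimately show "(\<Sum>v\<in>star G p i - {i}. g v - f v) \<le> f i"
      unfolding S_def by linarith
  qed
qed

section \<open>Counting totals and roundings\<close>

text \<open>These are the weak compositions of \<open>k\<close> indexed by \<open>I\<close>,
  extended by zero to match \<open>star_total\<close>.\<close>

definition supported_totals :: "'a set \<Rightarrow> 'a set \<Rightarrow> nat \<Rightarrow> ('a \<Rightarrow> nat) set" where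
  "supported_totals V I k = {t \<in> V \<rightarrow>\<^sub>E UNIV. (\<forall>v\<in>V - I. t v = 0) \<and> sum t I = k}"

text \<open>The fixed sum determines the value at one vertex \<open>j\<close> of \<open>I\<close>
  from the others, which saves one factor \<open>k + 1\<close>.\<close>

lemma card_supported_totals:
  assumes "finite I" "I \<noteq> {}" "I \<subseteq> V"
  shows "finite (supported_totals V I k)" "card (supported_totals V I k) \<le> (k + 1) ^ (card I - 1)"
proof -
  obtain j where j: "j \<in> I" using assms(2) by blast
  define J where "J = I - {j}"
  have J: "finite J" "card J = card I - 1"
    using assms(1) j by (auto simp: J_def)
  have inj: "inj_on (\<lambda>t. restrict t J) (supported_totals V I k)"
  proof (rule inj_onI)
    fix s t assume s: "s \<in> supported_totals V I k" and t: "t \<in> supported_totals V I k"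
      and "restrict s J = restrict t J"
    then have eq: "s v = t v" if "v \<in> J" for v
      using that by (metis restrict_apply')
    have "s j + sum s J = t j + sum t J"
      using s t j assms(1) by (simp add: supported_totals_def J_def sum.remove[of I j])
    then have "s j = t j" using eq by simp
    show "s = t"
    proof (rule PiE_ext)
      show "s \<in> V \<rightarrow>\<^sub>E UNIV" "t \<in> V \<rightarrow>\<^sub>E UNIV"
        using s t by (auto simp: supported_totals_def)
      show "s v = t v" if "v \<in> V" for v
        using s t that eq \<open>s j = t j\<close> by (cases "v \<in> I") (auto simp: supported_totals_def J_def)
    qed
  qed
  have sub: "(\<lambda>t. restrict t J) ` supported_totals V I k \<subseteq> J \<rightarrow>\<^sub>E {..k}"
    using assms(1) by (fastforce simp: supported_totals_def J_def intro: member_le_sum)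
  have fin: "finite (J \<rightarrow>\<^sub>E {..k})"
    using J by (intro finite_PiE) auto
  show "finite (supported_totals V I k)"
    using inj_on_finite[OF inj sub fin] .
  show "card (supported_totals V I k) \<le> (k + 1) ^ (card I - 1)"
    using card_inj_on_le[OF inj sub fin] J by (simp add: card_PiE)
qed

lemma sum_fibres_eq:
  assumes "finite (pverts G)" "p \<in> pverts G \<rightarrow> pverts G"
  shows "(\<Sum>i\<in>p ` pverts G. sum f (star G p i)) = sum f (pverts G)"
  unfolding star_def using assms sum.image_gen[of "pverts G" f p] by simp

lemma star_total_in_supported_totals:
  assumes "finite (pverts G)" "star_map G p" "f \<in> configurations G k"
  shows "star_total G p f \<in> supported_totals (pverts G) (p ` pverts G) k"
proof -
  have p: "p \<in> pverts G \<rightarrow> pverts G" using assms(2) by (auto simp: star_map_def)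
  have "star G p v = {}" if "v \<notin> p ` pverts G" for v
    using that by (auto simp: star_def)
  moreover have "sum (star_total G p f) (p ` pverts G) = (\<Sum>i\<in>p ` pverts G. sum f (star G p i))"
    using p by (intro sum.cong) (auto simp: star_total_def)
  ultimately show ?thesis
    using assms(3) sum_fibres_eq[OF assms(1) p, of f]
    by (auto simp: supported_totals_def star_total_def configurations_def)
qed

text \<open>Each vertex belongs to its own star, so its share of the total is at most 1; the bound
  does not depend on \<open>k\<close>.\<close>

lemma rounding_bounded:
  assumes "finite (pverts G)"
  shows "rounding G p f \<in> pverts G \<rightarrow>\<^sub>E {..(card (pverts G))\<^sup>2}"
proof -
  have "f v * N div sum f (star G p (p v)) \<le> N" if "v \<in> pverts G" for v N
  proof -
    have "f v \<le> sum f (star G p (p v))"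
      using assms that by (intro member_le_sum) (auto simp: star_def)
    then have "f v * N div sum f (star G p (p v)) \<le> sum f (star G p (p v)) * N div sum f (star G p (p v))"
      by (intro div_le_mono mult_le_mono1)
    also have "\<dots> \<le> N" by simp
    finally show ?thesis .
  qed
  then show ?thesis by (auto simp: rounding_def)
qed

section \<open>Colouring the configurations\<close>

text \<open>Colour a configuration by its chosen star map, totals and rounding. Distinct
  configurations of one colour are adjacent, so \<open>S\<close> has at most as many elements as
  there are colours.\<close>

lemma card_independent_pebbles_le:
  assumes sym: "sym (parcs G)" and fin: "finite (pverts G)" and ne: "pverts G \<noteq> {}"
    and S: "S \<in> independent_sets (pebble_graph G k)"
  defines "n \<equiv> card (pverts G)"
  shows "card S \<le> n ^ n * (n\<^sup>2 + 1) ^ n * (k + 1) ^ (independence_number G - 1)"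
proof -
  define V where "V = pverts G"
  define P where "P = {p. star_map G p}"
  define T where "T p = supported_totals V (p ` V) k" for p
  define Q where "Q = V \<rightarrow>\<^sub>E {..n\<^sup>2}"
  have fV: "finite V" using fin by (simp add: V_def)
  have SC: "S \<subseteq> configurations G k"
    using S by (auto simp: independent_sets_def pebble_graph_def)
  have "\<exists>p. star_map G p \<and> (\<forall>v\<in>V. f v \<le> f (p v))" for f :: "'a \<Rightarrow> nat"
    using ex_dominating_star_map[OF sym fin] by (simp add: V_def)
  then obtain c where c: "star_map G (c f)" "\<And>v. v \<in> V \<Longrightarrow> f v \<le> f (c f v)" for f :: "'a \<Rightarrow> nat"
    by metis
  define col where "col f = (c f, star_total G (c f) f, rounding G (c f) f)" for f
  have inj: "inj_on col S"
  proof (rule inj_onI, rule ccontr)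
    fix f g assume fg: "f \<in> S" "g \<in> S" "col f = col g" "f \<noteq> g"
    have "pebble_move G k f g"
    proof (rule pebble_move_of_same_rounding[OF sym fin])
      show "star_map G (c f)" "f \<in> configurations G k"
        "star_total G (c f) f = star_total G (c f) g" "rounding G (c f) f = rounding G (c f) g"
        using c fg SC by (auto simp: col_def)
      show "f v \<le> f (c f v)" if "v \<in> pverts G" for v
        using c(2) that by (simp add: V_def)
    qed
    then show False
      using fg SC S by (auto simp: independent_sets_def pebble_graph_def pairwise_def)
  qed
  \<comment> \<open>A dependent sum is used because the possible totals vary with the star
    map.\<close>
  have sub: "col ` S \<subseteq> (SIGMA p:P. T p \<times> Q)"
  proof (rule image_subsetI)
    fix f assume "f \<in> S"
    then have "star_total G (c f) f \<in> T (c f)"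
      using c(1) SC star_total_in_supported_totals[OF fin] by (auto simp: T_def V_def)
    moreover have "rounding G (c f) f \<in> Q"
      unfolding Q_def V_def n_def by (rule rounding_bounded[OF fin])
    ultimately show "col f \<in> (SIGMA p:P. T p \<times> Q)"
      using c(1) by (simp add: col_def P_def)
  qed
  have PV: "P \<subseteq> V \<rightarrow>\<^sub>E V" by (auto simp: P_def star_map_def V_def)
  have fVV: "finite (V \<rightarrow>\<^sub>E V)" using fV by (intro finite_PiE) auto
  have fP: "finite P" using PV fVV finite_subset by blast
  have cP: "card P \<le> n ^ n"
    using card_mono[OF fVV PV] fV by (simp add: card_PiE n_def V_def)
  have fQ: "finite Q" using fV by (auto simp: Q_def intro: finite_PiE)
  have cQ: "card Q = (n\<^sup>2 + 1) ^ n" using fV by (simp add: Q_def card_PiE n_def V_def)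
  have T: "finite (T p)" "card (T p) \<le> (k + 1) ^ (independence_number G - 1)" if "p \<in> P" for p
  proof -
    have pV: "p ` V \<subseteq> V" using that PV by auto
    have *: "finite (p ` V)" "p ` V \<noteq> {}" using fV ne by (auto simp: V_def)
    \<comment> \<open>The centres form an independent set; this is where the exponent comes
      from.\<close>
    have "card (p ` V) \<le> independence_number G"
      using that fin by (intro card_le_independence_number) (auto simp: P_def star_map_def V_def)
    then have "(k + 1) ^ (card (p ` V) - 1) \<le> (k + 1) ^ (independence_number G - 1)"
      by (intro power_increasing) auto
    then show "finite (T p)" "card (T p) \<le> (k + 1) ^ (independence_number G - 1)"
      using card_supported_totals[OF * pV, of k] by (auto simp: T_def)
  qed
  have fin_colours: "finite (SIGMA p:P. T p \<times> Q)"
    using fP T fQ by (intro finite_SigmaI) auto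
  have "card S \<le> card (SIGMA p:P. T p \<times> Q)"
    using card_inj_on_le[OF inj sub fin_colours] .
  also have "\<dots> = (\<Sum>p\<in>P. card (T p) * card Q)"
    using fP T fQ by (simp add: card_cartesian_product)
  also have "\<dots> \<le> card P * ((k + 1) ^ (independence_number G - 1) * card Q)"
    using T by (intro sum_bounded_above[where 'a = nat, simplified]) auto
  also have "\<dots> \<le> n ^ n * ((k + 1) ^ (independence_number G - 1) * card Q)"
    using cP by (rule mult_le_mono1)
  finally show ?thesis by (simp add: cQ mult_ac)
qed

section \<open>A constant uniform in \<open>k\<close>\<close>

theorem theorem2:
  fixes G :: "'a pair_pre_digraph"
  assumes "pair_graph G"
  shows "\<exists>C :: real. \<forall>k :: nat. k \<ge> 1 \<longrightarrow>
    real (independence_number (pebble_graph G k)) \<le> C * real k powi (int (independence_number G) - 1)"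
proof -
  interpret pair_graph G by fact
  have sym: "sym (parcs G)"
    using pair_sym_arcs by (simp add: symmetric_def)
  have fin: "finite (pverts G)" by simp
  have finC: "finite (pverts (pebble_graph G k))" for k
    using finite_configurations[OF fin] by (simp add: pebble_graph_def)
  define n where "n = card (pverts G)"
  define a where "a = independence_number G - 1"
  define N where "N = n ^ n * (n\<^sup>2 + 1) ^ n"
  show ?thesis
  proof (cases "pverts G = {}")
    case True
    \<comment> \<open>Without vertices a positive number of pebbles has no configuration, so
      \<open>C = 0\<close> copes with the exponent -1.\<close>
    have "independence_number (pebble_graph G k) \<le> 0" if "k \<ge> 1" for k
      using True that
      by (intro independence_number_le[OF finC])
         (auto simp: independent_sets_def pebble_graph_def configurations_def)
    then show ?thesis by (intro exI[of _ 0]) simp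
  next
    case False
    then obtain v where "v \<in> pverts G" by blast
    \<comment> \<open>A single vertex makes the independence number positive, so the natural
      subtraction in \<open>a\<close> does not truncate.\<close>
    then have "card {v} \<le> independence_number G"
      by (intro card_le_independence_number[OF fin]) (simp add: independent_sets_def)
    then have a: "int (independence_number G) - 1 = int a" by (simp add: a_def)
    have "real (independence_number (pebble_graph G k)) \<le> real (N * 2 ^ a) * real k powi int a"
      if k: "k \<ge> 1" for k
    proof -
      have "independence_number (pebble_graph G k) \<le> N * (k + 1) ^ a"
        unfolding N_def n_def a_def
        by (intro independence_number_le[OF finC] card_independent_pebbles_le[OF sym fin False])
      \<comment> \<open>Here \<open>k \<ge> 1\<close> enters through
        \<open>k + 1 \<le> 2 * k\<close>, giving the factor \<open>2 ^ a\<close> in the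
        constant.\<close>
      also have "\<dots> \<le> N * (2 * k) ^ a"
        using k by (intro mult_le_mono2 power_mono) auto
      finally have "independence_number (pebble_graph G k) \<le> N * 2 ^ a * k ^ a"
        by (simp add: power_mult_distrib mult_ac)
      then show ?thesis
        unfolding power_int_of_nat of_nat_power[symmetric] of_nat_mult[symmetric] of_nat_le_iff .
    qed
    then show ?thesis unfolding a by blast
  qed
qed

end
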